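(* For $\varepsilon_1,\varepsilon_2\in\{1,-1\}$ let $$\Omega(\varepsilon_1,\varepsilon_2)=\left\{A\in\mathrm{Sp}(2)\;\middle|\; A+\begin{bmatrix}\varepsilon_1&0\\0&\varepsilon_2\end{bmatrix}\text{ is invertible}\right\}.$$ The four open subsets $\Omega(1,1)$, $\Omega(-1,-1)$, $\Omega(1,-1)$ and $\Omega(-1,1)$ constitute a categorical open cover of $\mathrm{Sp}(2)$; that is, their union is $\mathrm{Sp}(2)$ and each of them is a categorical open subset of $\mathrm{Sp}(2)$.
   Context: $\mathbb{H}$ denotes the quaternions, $M^*$ the conjugate transpose of a quaternionic matrix $M$, and $\mathrm{Sp}(2)$ is the Lie group of matrices $A\in\mathbb{H}^{2\times 2}$ with $AA^*=I_2$. An open subset $U$ of a topological space $X$ is called categorical if $U$ is contractible in $X$, i.e. the inclusion $U\hookrightarrow X$ is homotopic to a constant map. (In the notation of the paper the four sets are $\Omega(I_2)$, $\Omega(-I_2)$, $\Omega(I_1,-I_1)$, $\Omega(-I_1,I_1)$.) *)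

theory Defs
  imports "HOL-Analysis.Analysis"
begin

section \<open>Quaternions\<close>

text \<open>\<open>Quat a b c d\<close> is the quaternion \<open>a + b i + c j + d k\<close>.\<close>

datatype quaternion = Quat (qRe: real) (qI: real) (qJ: real) (qK: real)

lemma quaternion_eq_iff:
  "x = y \<longleftrightarrow> qRe x = qRe y \<and> qI x = qI y \<and> qJ x = qJ y \<and> qK x = qK y"
  by (auto intro: quaternion.expand)

instantiation quaternion :: ring_1
begin

definition "0 = Quat 0 0 0 0"
definition "1 = Quat 1 0 0 0"
definition "x + y = Quat (qRe x + qRe y) (qI x + qI y) (qJ x + qJ y) (qK x + qK y)"
definition "- x = Quat (- qRe x) (- qI x) (- qJ x) (- qK x)"
definition "x - y = Quat (qRe x - qRe y) (qI x - qI y) (qJ x - qJ y) (qK x - qK y)"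
definition "x * y = Quat
  (qRe x * qRe y - qI x * qI y - qJ x * qJ y - qK x * qK y)
  (qRe x * qI y + qI x * qRe y + qJ x * qK y - qK x * qJ y)
  (qRe x * qJ y - qI x * qK y + qJ x * qRe y + qK x * qI y)
  (qRe x * qK y + qI x * qJ y - qJ x * qI y + qK x * qRe y)"

lemma quaternion_arith_sel [simp]:
  "qRe 0 = 0" "qI 0 = 0" "qJ 0 = 0" "qK 0 = 0"
  "qRe 1 = 1" "qI 1 = 0" "qJ 1 = 0" "qK 1 = 0"
  "qRe (x + y) = qRe x + qRe y" "qI (x + y) = qI x + qI y"
  "qJ (x + y) = qJ x + qJ y" "qK (x + y) = qK x + qK y"
  "qRe (- x) = - qRe x" "qI (- x) = - qI x" "qJ (- x) = - qJ x" "qK (- x) = - qK x"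
  "qRe (x - y) = qRe x - qRe y" "qI (x - y) = qI x - qI y"
  "qJ (x - y) = qJ x - qJ y" "qK (x - y) = qK x - qK y"
  "qRe (x * y) = qRe x * qRe y - qI x * qI y - qJ x * qJ y - qK x * qK y"
  "qI (x * y) = qRe x * qI y + qI x * qRe y + qJ x * qK y - qK x * qJ y"
  "qJ (x * y) = qRe x * qJ y - qI x * qK y + qJ x * qRe y + qK x * qI y"
  "qK (x * y) = qRe x * qK y + qI x * qJ y - qJ x * qI y + qK x * qRe y"
  by (simp_all add: zero_quaternion_def one_quaternion_def plus_quaternion_def
      uminus_quaternion_def minus_quaternion_def times_quaternion_def)

instance
  by standard (simp_all add: quaternion_eq_iff algebra_simps)

end

instantiation quaternion :: real_vector
begin

definition "r *\<^sub>R x = Quat (r * qRe x) (r * qI x) (r * qJ x) (r * qK x)"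

lemma quaternion_scaleR_sel [simp]:
  "qRe (r *\<^sub>R x) = r * qRe x" "qI (r *\<^sub>R x) = r * qI x"
  "qJ (r *\<^sub>R x) = r * qJ x" "qK (r *\<^sub>R x) = r * qK x"
  by (simp_all add: scaleR_quaternion_def)

instance
  by standard (simp_all add: quaternion_eq_iff algebra_simps)

end

instantiation quaternion :: real_inner
begin

definition "x \<bullet> y = qRe x * qRe y + qI x * qI y + qJ x * qJ y + qK x * qK y"
definition "norm (x :: quaternion) = sqrt (x \<bullet> x)"
definition "sgn (x :: quaternion) = inverse (norm x) *\<^sub>R x"
definition "dist (x :: quaternion) y = norm (x - y)"
definition [code del]: "(uniformity :: (quaternion \<times> quaternion) filter) =
  (INF e\<in>{0<..}. principal {(x, y). dist x y < e})"
definition [code del]: "open (U :: quaternion set) \<longleftrightarrow>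
  (\<forall>x\<in>U. eventually (\<lambda>(x', y). x' = x \<longrightarrow> y \<in> U) uniformity)"

instance
proof
  fix x y z :: quaternion and r s :: real
  show "x \<bullet> x = 0 \<longleftrightarrow> x = 0"
    by (auto simp: quaternion_eq_iff inner_quaternion_def add_nonneg_eq_0_iff)
  show "sgn x = x /\<^sub>R norm x"
    by (rule sgn_quaternion_def)
  show "dist x y = norm (x - y)"
    by (rule dist_quaternion_def)
  show "norm x = sqrt (x \<bullet> x)"
    by (rule norm_quaternion_def)
qed (auto simp: quaternion_eq_iff inner_quaternion_def algebra_simps
    uniformity_quaternion_def open_quaternion_def)

end

lemma norm_quaternion_eq:
  "norm x = sqrt ((qRe x)\<^sup>2 + (qI x)\<^sup>2 + (qJ x)\<^sup>2 + (qK x)\<^sup>2)"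
  by (simp add: norm_quaternion_def inner_quaternion_def power2_eq_square)

instance quaternion :: real_normed_algebra_1
proof
  fix x y :: quaternion and r :: real
  show "norm (x * y) \<le> norm x * norm y"
    unfolding norm_quaternion_eq real_sqrt_mult[symmetric]
    by (rule real_sqrt_le_mono) (simp add: power2_eq_square algebra_simps)
  show "norm (1 :: quaternion) = 1"
    by (simp add: norm_quaternion_eq)
qed (simp_all add: quaternion_eq_iff algebra_simps)

definition qcnj :: "quaternion \<Rightarrow> quaternion"
  where "qcnj x = Quat (qRe x) (- qI x) (- qJ x) (- qK x)"


section \<open>The group $\mathrm{Sp}(2)$\<close>

definition conj_transpose :: "quaternion^'n^'m \<Rightarrow> quaternion^'m^'n"
  where "conj_transpose A = transpose (map_matrix qcnj A)"

text \<open>\<^const>\<open>matrix_matrix_mult\<close> multiplies the entries in the order $A_{ik} B_{kj}$, as is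
  required over the noncommutative \<^typ>\<open>quaternion\<close>. The topology is the subspace topology
  from \<^typ>\<open>quaternion^2^2\<close>.\<close>

definition Sp2 :: "(quaternion^2^2) set"
  where "Sp2 = {A. A ** conj_transpose A = mat 1}"

definition diag2 :: "quaternion \<Rightarrow> quaternion \<Rightarrow> quaternion^2^2"
  where "diag2 a b = vector [vector [a, 0], vector [0, b]]"

definition Omega :: "quaternion \<Rightarrow> quaternion \<Rightarrow> (quaternion^2^2) set"
  where "Omega e1 e2 = {A \<in> Sp2. invertible (A + diag2 e1 e2)}"


section \<open>Categorical open subsets\<close>

definition categorical_openin :: "'a topology \<Rightarrow> 'a set \<Rightarrow> bool"
  where "categorical_openin X U \<longleftrightarrow> openin X U \<and>
    (\<exists>a\<in>topspace X. homotopic_with (\<lambda>_. True) (subtopology X U) X id (\<lambda>_. a))"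

definition categorical_open_cover :: "'a topology \<Rightarrow> 'a set set \<Rightarrow> bool"
  where "categorical_open_cover X \<U> \<longleftrightarrow>
    \<Union>\<U> = topspace X \<and> (\<forall>U\<in>\<U>. categorical_openin X U)"

end

theory Submission
  imports Defs
begin

text \<open>
  The elements of \<^const>\<open>Sp2\<close> are exactly the quaternionic $2 \times 2$ matrices whose action on column
  vectors preserves the norm (\<open>unitary_group_iff_norm_preserving\<close>). The contraction rests on
  this description.

  \<^emph>\<open>Contraction.\<close> Let $A$ and $D$ be unitary with $A + D$ invertible. The Cayley transform
  $X = (I - A D^{-1})(I + A D^{-1})^{-1}$ is skew-Hermitian and can be shrunk linearly to $0$.
  Transforming $(1 - s) X$ back gives, after clearing denominators, the path
  $$H_s(A) = \bigl(sD + (2-s)A\bigr)\,\bigl((2-s)D + sA\bigr)^{-1} D, \qquad 0 \le s \le 1,$$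
  which leads from $H_0(A) = A$ to $H_1(A) = D$. For every vector $x$ the two vectors $Dx$ and $Ax$
  have the same norm, so $sDx + (2-s)Ax$ and $(2-s)Dx + sAx$ have the same norm as well, and hence
  $H_s(A)$ is again unitary. The same remark shows that the inverse exists: if
  $(2-s)Dx = -sAx$ with $x \neq 0$, then $2 - s = s$, so $s = 1$ and $(A + D)x = 0$.

  \<^emph>\<open>Topology.\<close> For each $D$, the map $(s, A) \mapsto H_s(A)$ takes values in a
  compact space, and its graph is cut out by an equation between continuous functions that involves no inverse; so it is continuous
  (\<open>continuous_on_Cayley_contraction\<close>). Likewise the singular matrices form a closed set, being
  those that annihilate a point of the compact unit sphere (\<open>open_invertible\<close>).

  \<^emph>\<open>Covering.\<close> For a quaternionic $2 \times 2$ matrix with rows $(a, b)$, $(c, d)$ and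
  $b \neq 0$, singularity of the sum with $\mathrm{diag}(\varepsilon_1, \varepsilon_2)$ forces
  $c = (d + \varepsilon_2) b^{-1} (a + \varepsilon_1)$, which cannot hold for all four choices of
  signs. If $b = 0$ the sum is triangular, and the signs can be chosen to keep its diagonal free
  of zeros.
\<close>

section \<open>Quaternions as a Euclidean division algebra\<close>

instantiation quaternion :: euclidean_space
begin

definition Basis_quaternion_def:
  "Basis = {Quat 1 0 0 0, Quat 0 1 0 0, Quat 0 0 1 0, Quat 0 0 0 1}"

instance
proof
  fix u v x :: quaternion
  show "u \<bullet> v = (if u = v then 1 else 0)" if "u \<in> Basis" "v \<in> Basis"
    using that unfolding Basis_quaternion_def
    by (elim insertE emptyE) (simp_all add: inner_quaternion_def)
  show "(\<forall>u\<in>Basis. x \<bullet> u = 0) \<longleftrightarrow> x = 0"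
    by (simp add: Basis_quaternion_def inner_quaternion_def quaternion_eq_iff[of x 0])
qed (simp_all add: Basis_quaternion_def)

end

lemma qcnj_sel [simp]:
  "qRe (qcnj x) = qRe x" "qI (qcnj x) = - qI x" "qJ (qcnj x) = - qJ x" "qK (qcnj x) = - qK x"
  by (simp_all add: qcnj_def)

lemma qcnj_0: "qcnj 0 = 0"
  by (simp add: quaternion_eq_iff)

lemma inner_mult_qcnj: "(a * b) \<bullet> c = b \<bullet> (qcnj a * c)"
  by (simp add: inner_quaternion_def algebra_simps)

lemma mult_qcnj: "x * qcnj x = (norm x)\<^sup>2 *\<^sub>R 1" and qcnj_mult: "qcnj x * x = (norm x)\<^sup>2 *\<^sub>R 1"
  by (simp_all add: quaternion_eq_iff norm_eq_sqrt_inner inner_quaternion_def)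

lemma bounded_linear_qcnj: "bounded_linear qcnj"
  by (rule bounded_linear_intro[where K = 1])
    (simp_all add: quaternion_eq_iff norm_quaternion_eq)

lemmas continuous_on_qcnj [continuous_intros] =
  bounded_linear.continuous_on[OF bounded_linear_qcnj]

instantiation quaternion :: division_ring
begin

definition "inverse (x :: quaternion) = inverse ((norm x)\<^sup>2) *\<^sub>R qcnj x"
definition "x div (y :: quaternion) = x * inverse y"

instance
proof
  fix a b :: quaternion
  show "inverse a * a = 1" "a * inverse a = 1" if "a \<noteq> 0"
    using that by (simp_all add: inverse_quaternion_def qcnj_mult mult_qcnj)
  show "a div b = a * inverse b"
    by (rule divide_quaternion_def)
  show "inverse (0 :: quaternion) = 0"
    by (simp add: inverse_quaternion_def)
qed

end


section \<open>Matrices over finite-dimensional algebras\<close>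

lemma continuous_on_matrix_matrix_mult [continuous_intros]:
  fixes f :: "'t::topological_space \<Rightarrow> 'a::{real_normed_algebra_1}^'n^'m"
    and g :: "'t \<Rightarrow> 'a^'k^'n"
  assumes "continuous_on S f" "continuous_on S g"
  shows "continuous_on S (\<lambda>t. f t ** g t)"
  unfolding matrix_matrix_mult_def by (intro continuous_intros assms)

lemma continuous_on_matrix_vector_mult [continuous_intros]:
  fixes f :: "'t::topological_space \<Rightarrow> 'a::{real_normed_algebra_1}^'n^'m"
    and g :: "'t \<Rightarrow> 'a^'n"
  assumes "continuous_on S f" "continuous_on S g"
  shows "continuous_on S (\<lambda>t. f t *v g t)"
  unfolding matrix_vector_mult_def by (intro continuous_intros assms)

lemma scaleR_matrix_vector_mult:
  fixes A :: "'a::real_algebra_1^'n^'m"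
  shows "(r *\<^sub>R A) *v x = r *\<^sub>R (A *v x)"
  by (simp add: matrix_vector_mult_def vec_eq_iff scaleR_sum_right)

lemma matrix_vector_mult_scaleR_right:
  fixes A :: "'a::real_algebra_1^'n^'m"
  shows "A *v (r *\<^sub>R x) = r *\<^sub>R (A *v x)"
  by (simp add: matrix_vector_mult_def vec_eq_iff scaleR_sum_right)

lemma linear_matrix_vector_mult:
  fixes A :: "'a::real_algebra_1^'n^'m"
  shows "linear ((*v) A)"
  by (rule linearI) (simp_all add: matrix_vector_right_distrib matrix_vector_mult_scaleR_right)

text \<open>An injective square matrix acts as an injective real-linear endomorphism of a
  finite-dimensional real space. It is therefore surjective, and preimages of the standard basis
  vectors are the columns of a right inverse.\<close>

lemma invertible_iff_trivial_kernel:
  fixes A :: "'a::{real_algebra_1, euclidean_space}^'n^'n"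
  shows "invertible A \<longleftrightarrow> (\<forall>x. A *v x = 0 \<longrightarrow> x = 0)"
proof
  assume "invertible A"
  then show "\<forall>x. A *v x = 0 \<longrightarrow> x = 0"
    by (metis invertible_def matrix_vector_mul_assoc matrix_vector_mul_lid
        matrix_vector_mult_0_right)
next
  assume ker: "\<forall>x. A *v x = 0 \<longrightarrow> x = 0"
  have lin: "linear ((*v) A)"
    by (rule linear_matrix_vector_mult)
  have inj: "inj ((*v) A)"
    using ker linear_injective_0[OF lin] by blast
  then have "surj ((*v) A)"
    using lin linear_injective_imp_surjective by blast
  then have "\<forall>j. \<exists>v. A *v v = axis j 1"
    by (metis surjD)
  then obtain v where v: "\<And>j. A *v v j = axis j 1"
    by metis
  define B where "B = (\<chi> i j. v j $ i)"
  have "(A ** B) $ i $ j = (A *v v j) $ i" for i j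
    by (simp add: B_def matrix_matrix_mult_def matrix_vector_mult_def)
  then have AB: "A ** B = mat 1"
    by (simp add: v vec_eq_iff mat_def axis_def)
  have "(B ** A) *v x = mat 1 *v x" for x
    by (rule injD[OF inj]) (simp add: matrix_vector_mul_assoc matrix_mul_assoc AB)
  then have "B ** A = mat 1"
    unfolding matrix_eq by blast
  with AB show "invertible A"
    unfolding invertible_def by blast
qed

lemma
  fixes A :: "'a::semiring_1^'n^'m"
  assumes "invertible A"
  shows matrix_mul_matrix_inv: "A ** matrix_inv A = mat 1"
    and matrix_inv_mul_matrix: "matrix_inv A ** A = mat 1"
  using someI_ex[OF assms[unfolded invertible_def]] unfolding matrix_inv_def by blast+

lemma right_inverse_imp_left_inverse:
  fixes A B :: "'a::{real_algebra_1, euclidean_space}^'n^'n"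
  assumes "A ** B = mat 1"
  shows "B ** A = mat 1"
proof -
  have "invertible B"
    unfolding invertible_iff_trivial_kernel
    by (metis assms matrix_vector_mul_assoc matrix_vector_mul_lid matrix_vector_mult_0_right)
  then show ?thesis
    by (metis assms matrix_mul_assoc matrix_mul_lid matrix_mul_rid matrix_mul_matrix_inv)
qed

text \<open>A singular matrix annihilates a unit vector, so the set of singular matrices is the
  projection of a closed set along the compact unit sphere.\<close>

lemma open_invertible:
  "open {A :: ('a::{real_normed_algebra_1, euclidean_space}^'n^'n). invertible A}"
proof -
  let ?Z = "{z :: ('a^'n) \<times> ('a^'n^'n). snd z *v fst z = 0}"
  have "closed ?Z"
    by (intro closed_Collect_eq continuous_intros)
  then have "closed {A :: 'a^'n^'n. \<exists>x. x \<in> sphere 0 1 \<and> (x, A) \<in> ?Z}"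
    by (intro closed_compact_projection) auto
  also have "{A :: 'a^'n^'n. \<exists>x. x \<in> sphere 0 1 \<and> (x, A) \<in> ?Z} = {A. \<not> invertible A}"
  proof -
    have "\<exists>y. norm y = 1 \<and> A *v y = 0" if "A *v x = 0" "x \<noteq> 0" for A :: "'a^'n^'n" and x
      using that
      by (intro exI[of _ "(1 / norm x) *\<^sub>R x"]) (simp add: matrix_vector_mult_scaleR_right)
    then show ?thesis
      unfolding invertible_iff_trivial_kernel by auto
  qed
  finally show ?thesis
    by (simp add: closed_def Compl_eq)
qed


section \<open>Quaternionic unitary matrices\<close>

definition unitary_group :: "(quaternion^'n^'n) set"
  where "unitary_group = {A. A ** conj_transpose A = mat 1}"

text \<open>The conjugate transpose is the adjoint for the \<^emph>\<open>real\<close> inner product, so that Euclidean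
  geometry applies without a quaternion-valued form.\<close>

lemma inner_matrix_vector_mult:
  fixes A :: "quaternion^'n^'m"
  shows "(A *v x) \<bullet> y = x \<bullet> (conj_transpose A *v y)"
proof -
  have "(A *v x) \<bullet> y = (\<Sum>i\<in>UNIV. \<Sum>j\<in>UNIV. x $ j \<bullet> (qcnj (A $ i $ j) * y $ i))"
    by (simp add: inner_vec_def matrix_vector_mult_def inner_sum_left inner_mult_qcnj)
  also have "\<dots> = (\<Sum>j\<in>UNIV. \<Sum>i\<in>UNIV. x $ j \<bullet> (qcnj (A $ i $ j) * y $ i))"
    by (rule sum.swap)
  also have "\<dots> = x \<bullet> (conj_transpose A *v y)"
    by (simp add: inner_vec_def matrix_vector_mult_def inner_sum_right conj_transpose_def
        transpose_def map_matrix_def)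
  finally show ?thesis .
qed

lemma unitary_group_left:
  "A \<in> unitary_group \<Longrightarrow> conj_transpose A ** A = mat 1"
  unfolding unitary_group_def by (auto intro: right_inverse_imp_left_inverse)

text \<open>A norm-preserving linear map preserves inner products by polarization, so the adjoint is a
  left inverse; a one-sided inverse of a square matrix is two-sided.\<close>

lemma unitary_group_iff_norm_preserving:
  "A \<in> unitary_group \<longleftrightarrow> (\<forall>x. norm (A *v x) = norm x)"
proof
  assume "A \<in> unitary_group"
  then have "(A *v x) \<bullet> (A *v x) = x \<bullet> x" for x
    by (simp add: inner_matrix_vector_mult matrix_vector_mul_assoc unitary_group_left)
  then show "\<forall>x. norm (A *v x) = norm x"
    by (simp add: norm_eq_sqrt_inner)
next
  assume "\<forall>x. norm (A *v x) = norm x"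
  then have "orthogonal_transformation ((*v) A)"
    by (simp add: orthogonal_transformation linear_matrix_vector_mult)
  then have "(A *v x) \<bullet> (A *v y) = x \<bullet> y" for x y
    by (simp add: orthogonal_transformation_def)
  then have "x \<bullet> ((conj_transpose A ** A) *v y - y) = 0" for x y
    by (simp add: inner_matrix_vector_mult matrix_vector_mul_assoc inner_diff_right)
  then have "(conj_transpose A ** A) *v y = mat 1 *v y" for y
    by (metis inner_eq_zero_iff eq_iff_diff_eq_0 matrix_vector_mul_lid)
  then have "conj_transpose A ** A = mat 1"
    unfolding matrix_eq by blast
  then show "A \<in> unitary_group"
    unfolding unitary_group_def by (auto intro: right_inverse_imp_left_inverse)
qed

lemma continuous_on_conj_transpose [continuous_intros]:
  assumes "continuous_on S f"
  shows "continuous_on S (\<lambda>t. conj_transpose (f t))"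
  unfolding conj_transpose_def transpose_def map_matrix_def
  by (simp add: continuous_intros assms)

text \<open>Every row of a unitary matrix is a unit vector, which bounds the norm.\<close>

lemma compact_unitary_group: "compact (unitary_group :: (quaternion^'n^'n) set)"
proof -
  have row: "norm (A $ i) = 1" if "A \<in> unitary_group" for A :: "quaternion^'n^'n" and i
  proof -
    have "(\<Sum>j\<in>UNIV. A $ i $ j * qcnj (A $ i $ j)) = 1"
      using that
      by (simp add: unitary_group_def vec_eq_iff mat_def matrix_matrix_mult_def
          conj_transpose_def transpose_def map_matrix_def)
    then have "(\<Sum>j\<in>UNIV. (norm (A $ i $ j))\<^sup>2) *\<^sub>R (1 :: quaternion) = 1 *\<^sub>R 1"
      by (simp add: mult_qcnj scaleR_sum_left)
    then have "(\<Sum>j\<in>UNIV. (norm (A $ i $ j))\<^sup>2) = 1"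
      by (metis scaleR_cancel_right zero_neq_one)
    then show ?thesis
      by (simp add: norm_vec_def L2_set_def)
  qed
  have "norm A \<le> real CARD('n)" if "A \<in> unitary_group" for A :: "quaternion^'n^'n"
    using L2_set_le_sum[of UNIV "\<lambda>i. norm (A $ i)"] by (simp add: norm_vec_def[of A] row[OF that])
  then have "bounded (unitary_group :: (quaternion^'n^'n) set)"
    by (auto simp: bounded_iff)
  moreover have "closed (unitary_group :: (quaternion^'n^'n) set)"
    unfolding unitary_group_def by (intro closed_Collect_eq continuous_intros)
  ultimately show ?thesis
    by (simp add: compact_eq_bounded_closed)
qed


section \<open>Contraction by a Cayley transform\<close>

lemma norm_combination_swap:
  fixes u v :: "'a::real_inner"
  assumes "norm u = norm v"
  shows "norm (r *\<^sub>R u + s *\<^sub>R v) = norm (s *\<^sub>R u + r *\<^sub>R v)"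
proof -
  have "u \<bullet> u = v \<bullet> v"
    using assms by (simp add: norm_eq)
  then show ?thesis
    by (simp add: norm_eq inner_simps inner_commute algebra_simps)
qed

text \<open>A kernel vector would satisfy \<open>(2 - s) D x = - s A x\<close>. Comparing norms leaves only \<open>s = 1\<close>,
  where the matrix is \<open>A + D\<close> itself.\<close>

lemma Cayley_denominator_invertible:
  fixes A D :: "quaternion^'n^'n"
  assumes A: "A \<in> unitary_group" and D: "D \<in> unitary_group"
    and inv: "invertible (A + D)" and s: "0 \<le> s" "s \<le> 1"
  shows "invertible ((2 - s) *\<^sub>R D + s *\<^sub>R A)"
  unfolding invertible_iff_trivial_kernel
proof (intro allI impI)
  fix x
  assume "((2 - s) *\<^sub>R D + s *\<^sub>R A) *v x = 0"
  then have eq: "(2 - s) *\<^sub>R (D *v x) + s *\<^sub>R (A *v x) = 0"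
    by (simp add: matrix_vector_mult_add_rdistrib scaleR_matrix_vector_mult)
  then have "norm ((2 - s) *\<^sub>R (D *v x)) = norm (s *\<^sub>R (A *v x))"
    by (metis add_eq_0_iff norm_minus_cancel)
  then have "(2 - s) * norm x = s * norm x"
    using A D s by (simp add: unitary_group_iff_norm_preserving)
  then have "x = 0 \<or> s = 1"
    by (simp add: algebra_simps)
  moreover have "x = 0" if "s = 1"
  proof -
    have "(A + D) *v x = 0"
      using eq that by (simp add: matrix_vector_mult_add_rdistrib add.commute)
    then show ?thesis
      using inv invertible_iff_trivial_kernel by blast
  qed
  ultimately show "x = 0"
    by blast
qed

text \<open>With \<open>X\<close> the Cayley transform of \<open>A D\<inverse>\<close>, this is the inverse Cayley transform of
  \<open>(1 - s) X\<close>, multiplied by \<open>D\<close> on the right. The parameter and the matrix are paired, as in the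
  domain of a homotopy.\<close>

definition Cayley_contraction ::
    "quaternion^'n^'n \<Rightarrow> real \<times> (quaternion^'n^'n) \<Rightarrow> quaternion^'n^'n"
  where "Cayley_contraction D = (\<lambda>(s, A).
    (s *\<^sub>R D + (2 - s) *\<^sub>R A) ** matrix_inv ((2 - s) *\<^sub>R D + s *\<^sub>R A) ** D)"

text \<open>Multiplying out the inverse characterizes the contraction by an equation whose two sides
  are continuous in all variables.\<close>

lemma Cayley_contraction_eq_iff:
  fixes A D :: "quaternion^'n^'n"
  assumes A: "A \<in> unitary_group" and D: "D \<in> unitary_group"
    and inv: "invertible (A + D)" and s: "0 \<le> s" "s \<le> 1"
  shows "Cayley_contraction D (s, A) = N \<longleftrightarrow>
    N ** conj_transpose D ** ((2 - s) *\<^sub>R D + s *\<^sub>R A) = s *\<^sub>R D + (2 - s) *\<^sub>R A"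
    (is "_ \<longleftrightarrow> N ** ?D' ** ?Q = ?P")
proof -
  note Q = Cayley_denominator_invertible[OF assms]
  have D': "D ** ?D' = mat 1" "?D' ** D = mat 1"
    using D unitary_group_left by (auto simp: unitary_group_def)
  have "?P ** matrix_inv ?Q ** D ** ?D' ** ?Q = ?P"
    by (simp add: matrix_mul_assoc[symmetric] D'(1) matrix_inv_mul_matrix[OF Q]
        matrix_mul_assoc[of D ?D'])
  moreover have "(N ** ?D' ** ?Q) ** matrix_inv ?Q ** D = N"
    by (simp add: matrix_mul_assoc[symmetric] D'(2) matrix_mul_assoc[of ?Q]
        matrix_mul_matrix_inv[OF Q])
  ultimately show ?thesis
    unfolding Cayley_contraction_def by auto
qed

text \<open>Numerator and denominator have the same effect on norms, because \<open>D x\<close> and \<open>A x\<close> are equally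
  long.\<close>

lemma Cayley_contraction_unitary:
  fixes A D :: "quaternion^'n^'n"
  assumes A: "A \<in> unitary_group" and D: "D \<in> unitary_group"
    and inv: "invertible (A + D)" and s: "0 \<le> s" "s \<le> 1"
  shows "Cayley_contraction D (s, A) \<in> unitary_group"
  unfolding unitary_group_iff_norm_preserving
proof
  fix x
  let ?P = "s *\<^sub>R D + (2 - s) *\<^sub>R A" and ?Q = "(2 - s) *\<^sub>R D + s *\<^sub>R A"
  have PQ: "norm (?P *v y) = norm (?Q *v y)" for y
    using A D
    by (simp add: matrix_vector_mult_add_rdistrib scaleR_matrix_vector_mult norm_combination_swap
        unitary_group_iff_norm_preserving)
  have "norm (Cayley_contraction D (s, A) *v x) = norm (?P *v (matrix_inv ?Q *v (D *v x)))"
    by (simp add: Cayley_contraction_def matrix_vector_mul_assoc matrix_mul_assoc)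
  also have "\<dots> = norm (?Q *v (matrix_inv ?Q *v (D *v x)))"
    by (rule PQ)
  also have "\<dots> = norm (D *v x)"
    by (simp add: matrix_vector_mul_assoc matrix_mul_assoc
        matrix_mul_matrix_inv[OF Cayley_denominator_invertible[OF assms]])
  also have "\<dots> = norm x"
    using D by (simp add: unitary_group_iff_norm_preserving)
  finally show "norm (Cayley_contraction D (s, A) *v x) = norm x" .
qed

lemma graph_eq_Int:
  fixes f :: "'a \<Rightarrow> 'b"
  assumes "f \<in> S \<rightarrow> T" "\<And>x y. x \<in> S \<Longrightarrow> f x = y \<longleftrightarrow> (x, y) \<in> C"
  shows "(\<lambda>x. (x, f x)) ` S = (S \<times> T) \<inter> C"
proof (rule set_eqI)
  fix p :: "'a \<times> 'b"
  obtain x y where p: "p = (x, y)"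
    by (rule prod.exhaust)
  have "p \<in> (\<lambda>x. (x, f x)) ` S \<longleftrightarrow> x \<in> S \<and> f x = y"
    unfolding p by auto
  also have "\<dots> \<longleftrightarrow> x \<in> S \<and> y \<in> T \<and> (x, y) \<in> C"
    using assms(2)[of x y] funcset_mem[OF assms(1), of x] by blast
  finally show "p \<in> (\<lambda>x. (x, f x)) ` S \<longleftrightarrow> p \<in> (S \<times> T) \<inter> C"
    unfolding p by simp
qed

text \<open>A map into a compact space is continuous as soon as its graph is closed.\<close>

lemma continuous_on_Cayley_contraction:
  fixes D :: "quaternion^'n^'n"
  assumes D: "D \<in> unitary_group"
  shows "continuous_on ({0..1} \<times> {A \<in> unitary_group. invertible (A + D)}) (Cayley_contraction D)"
    (is "continuous_on ?S ?f")
proof -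
  have maps: "?f \<in> ?S \<rightarrow> unitary_group"
    using D by (auto intro: Cayley_contraction_unitary)
  let ?C = "{z :: (real \<times> (quaternion^'n^'n)) \<times> (quaternion^'n^'n).
    snd z ** conj_transpose D ** ((2 - fst (fst z)) *\<^sub>R D + fst (fst z) *\<^sub>R snd (fst z)) =
    fst (fst z) *\<^sub>R D + (2 - fst (fst z)) *\<^sub>R snd (fst z)}"
  have "closed ?C"
    by (intro closed_Collect_eq continuous_intros)
  moreover have "(\<lambda>z. (z, ?f z)) ` ?S = (?S \<times> unitary_group) \<inter> ?C"
  proof (rule graph_eq_Int[OF maps])
    show "?f z = N \<longleftrightarrow> (z, N) \<in> ?C" if "z \<in> ?S" for z N
      using that Cayley_contraction_eq_iff[OF _ D, of "snd z" "fst z" N] by auto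
  qed
  ultimately have "closedin (top_of_set (?S \<times> unitary_group)) ((\<lambda>z. (z, ?f z)) ` ?S)"
    by (auto simp: closedin_closed)
  then show ?thesis
    using continuous_closed_graph_eq[OF compact_unitary_group maps] by blast
qed

lemma categorical_openin_unitary_group:
  fixes D :: "quaternion^'n^'n"
  assumes D: "D \<in> unitary_group"
  shows "categorical_openin (top_of_set unitary_group) {A \<in> unitary_group. invertible (A + D)}"
    (is "categorical_openin _ ?U")
proof -
  have "open ((\<lambda>A. A + D) -` {A. invertible A})"
    by (intro open_vimage open_invertible continuous_intros)
  moreover have "?U = unitary_group \<inter> (\<lambda>A. A + D) -` {A. invertible A}"
    by auto
  ultimately have op: "openin (top_of_set unitary_group) ?U"
    by (simp only: openin_open_Int)
  have start: "Cayley_contraction D (0, A) = A" if "A \<in> ?U" for A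
    using that D unitary_group_left[OF D]
    by (simp add: Cayley_contraction_eq_iff matrix_scalar_ac scalar_matrix_assoc[symmetric]
        matrix_mul_assoc[symmetric])
  have stop: "Cayley_contraction D (1, A) = D" if "A \<in> ?U" for A
    using that D
    by (simp add: Cayley_contraction_eq_iff unitary_group_def)
  have "homotopic_with_canon (\<lambda>_. True) ?U unitary_group id (\<lambda>_. D)"
  proof (subst homotopic_with, simp, intro exI conjI)
    have "Cayley_contraction D ` ({0..1} \<times> ?U) \<subseteq> unitary_group"
      using D by (auto intro: Cayley_contraction_unitary)
    then show "continuous_map (prod_topology (top_of_set {0..1}) (top_of_set ?U))
        (top_of_set unitary_group) (Cayley_contraction D)"
      using continuous_on_Cayley_contraction[OF D]
      by (simp add: image_subset_iff_funcset)
  qed (use start stop in auto)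
  moreover have "subtopology (top_of_set unitary_group) ?U = top_of_set ?U"
    by (simp add: subtopology_subtopology Int_absorb1)
  ultimately show ?thesis
    unfolding categorical_openin_def using op D by auto
qed


section \<open>The sign matrices and the covering\<close>

lemma matrix_vector_mult_2:
  fixes A :: "'a::semiring_1^2^2"
  shows "(A *v x) $ 1 = A $ 1 $ 1 * x $ 1 + A $ 1 $ 2 * x $ 2"
    and "(A *v x) $ 2 = A $ 2 $ 1 * x $ 1 + A $ 2 $ 2 * x $ 2"
  by (simp_all add: matrix_vector_mult_def sum_2)

lemma diag2_sel [simp]:
  "diag2 a b $ 1 $ 1 = a" "diag2 a b $ 1 $ 2 = 0" "diag2 a b $ 2 $ 1 = 0" "diag2 a b $ 2 $ 2 = b"
  by (simp_all add: diag2_def)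

lemma Sp2_eq_unitary_group: "Sp2 = unitary_group"
  by (simp add: Sp2_def unitary_group_def)

lemma diag2_in_Sp2:
  assumes "norm a = 1" "norm b = 1"
  shows "diag2 a b \<in> Sp2"
  using assms
  by (simp add: Sp2_def vec_eq_iff forall_2 mat_def matrix_matrix_mult_def sum_2
      conj_transpose_def transpose_def map_matrix_def mult_qcnj qcnj_0)

text \<open>A kernel vector of a matrix whose upper right entry is nonzero has nonzero first
  coordinate. Normalizing that coordinate to $1$ by a scalar on the right, which the action on
  column vectors allows, determines the second coordinate from the first row; the second row
  then gives the stated relation.\<close>

lemma singular_2x2_imp_entry_eq:
  fixes M :: "quaternion^2^2"
  assumes sing: "\<not> invertible M" and b: "M $ 1 $ 2 \<noteq> 0"
  shows "M $ 2 $ 1 = M $ 2 $ 2 * (inverse (M $ 1 $ 2) * M $ 1 $ 1)"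
proof -
  let ?a = "M $ 1 $ 1" and ?b = "M $ 1 $ 2" and ?c = "M $ 2 $ 1" and ?d = "M $ 2 $ 2"
  obtain x where "M *v x = 0" "x \<noteq> 0"
    using sing unfolding invertible_iff_trivial_kernel by blast
  then have row1: "?a * x $ 1 + ?b * x $ 2 = 0" and row2: "?c * x $ 1 + ?d * x $ 2 = 0"
    and nz: "x $ 1 \<noteq> 0 \<or> x $ 2 \<noteq> 0"
    by (auto simp: vec_eq_iff forall_2 matrix_vector_mult_2)
  have "x $ 1 \<noteq> 0"
    using row1 nz b by auto
  have "?b * x $ 2 = - (?a * x $ 1)"
    using row1 by (metis add.commute eq_neg_iff_add_eq_0)
  then have "inverse ?b * (?b * x $ 2) = - (inverse ?b * ?a * x $ 1)"
    by (simp add: mult.assoc)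
  then have "x $ 2 = - (inverse ?b * ?a * x $ 1)"
    using b by (simp add: mult.assoc[symmetric])
  with row2 have "(?c - ?d * (inverse ?b * ?a)) * x $ 1 = 0"
    by (simp add: algebra_simps)
  with \<open>x $ 1 \<noteq> 0\<close> show ?thesis
    by simp
qed

lemma ex_sign_add_nonzero: "\<exists>e\<in>{1, -1}. a + e \<noteq> (0 :: quaternion)"
proof -
  have "a + 1 \<noteq> 0 \<or> a + - 1 \<noteq> 0"
    by (auto simp: quaternion_eq_iff)
  then show ?thesis
    by blast
qed

lemma ex_sign_matrix_add_invertible:
  fixes A :: "quaternion^2^2"
  shows "\<exists>e1\<in>{1, -1}. \<exists>e2\<in>{1, -1}. invertible (A + diag2 e1 e2)"
proof (cases "A $ 1 $ 2 = 0")
  case True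
  obtain e1 e2 where e: "e1 \<in> {1, -1}" "e2 \<in> {1, -1}"
    and nz: "A $ 1 $ 1 + e1 \<noteq> 0" "A $ 2 $ 2 + e2 \<noteq> 0"
    using ex_sign_add_nonzero by meson
  have "invertible (A + diag2 e1 e2)"
    unfolding invertible_iff_trivial_kernel
    using nz True by (auto simp: vec_eq_iff forall_2 matrix_vector_mult_2)
  with e show ?thesis
    by blast
next
  case False
  let ?b' = "inverse (A $ 1 $ 2)" and ?a = "A $ 1 $ 1" and ?d = "A $ 2 $ 2"
  show ?thesis
  proof (rule ccontr)
    assume "\<not> ?thesis"
    then have *: "A $ 2 $ 1 = (?d + e2) * (?b' * (?a + e1))"
      if "e1 \<in> {1, -1}" "e2 \<in> {1, -1}" for e1 e2
      using that singular_2x2_imp_entry_eq[of "A + diag2 e1 e2"] False by auto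
    \<comment> \<open>Varying \<open>e1\<close> eliminates the entry \<open>?a\<close>; what remains would make \<open>?d + e2\<close> vanish for both
      signs.\<close>
    have "(?d + e2) * ?b' * 2 = 0" if "e2 \<in> {1, -1}" for e2
    proof -
      have "(?d + e2) * ?b' * 2 = (?d + e2) * ?b' * ((?a + 1) - (?a + - 1))"
        by simp
      also have "\<dots> = (?d + e2) * (?b' * (?a + 1)) - (?d + e2) * (?b' * (?a + - 1))"
        by (simp only: right_diff_distrib mult.assoc)
      also have "\<dots> = 0"
        using *[of 1 e2] *[of "-1" e2] that by simp
      finally show ?thesis .
    qed
    moreover have "?b' \<noteq> 0"
      using False right_inverse by fastforce
    moreover have "(2 :: quaternion) \<noteq> 0"
      unfolding one_add_one[symmetric] quaternion_eq_iff quaternion_arith_sel by simp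
    ultimately have "?d + e2 = 0" if "e2 \<in> {1, -1}" for e2
      using that by (simp only: mult_eq_0_iff) blast
    then show False
      using ex_sign_add_nonzero by blast
  qed
qed

theorem proposition4p6:
  shows "categorical_open_cover (top_of_set Sp2)
    {Omega 1 1, Omega (-1) (-1), Omega 1 (-1), Omega (-1) 1}"
proof -
  have "categorical_openin (top_of_set Sp2) (Omega e1 e2)"
    if "e1 \<in> {1, -1}" "e2 \<in> {1, -1}" for e1 e2
    using that categorical_openin_unitary_group[of "diag2 e1 e2"] diag2_in_Sp2[of e1 e2]
    by (auto simp: Omega_def Sp2_eq_unitary_group)
  moreover have "Sp2 \<subseteq> Omega 1 1 \<union> Omega (-1) (-1) \<union> Omega 1 (-1) \<union> Omega (-1) 1"
  proof
    fix A :: "quaternion^2^2"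
    assume "A \<in> Sp2"
    moreover obtain e1 e2 where "e1 \<in> {1, -1}" "e2 \<in> {1, -1}" "invertible (A + diag2 e1 e2)"
      using ex_sign_matrix_add_invertible by blast
    ultimately show "A \<in> Omega 1 1 \<union> Omega (-1) (-1) \<union> Omega 1 (-1) \<union> Omega (-1) 1"
      by (auto simp: Omega_def)
  qed
  moreover have "Omega e1 e2 \<subseteq> Sp2" for e1 e2
    by (auto simp: Omega_def)
  ultimately show ?thesis
    unfolding categorical_open_cover_def by (simp add: subset_antisym Un_assoc)
qed

end
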